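(* Let $X$ be a set, $E$ a set of parameters, and let $\boldsymbol{\Sigma}=\{\Sigma_e : e\in E\}$ be a family of crisp topologies on $X$ indexed by $E$. Then $(X,\Sigma_e)$ is a normal space for each $e\in E$ if and only if $\mathcal{T}(\boldsymbol{\Sigma})$ is a soft normal space.
   Context: A "crisp" topology is an ordinary topology; a crisp space is normal if any two disjoint closed sets are contained in disjoint open sets (no $T_1$ assumption). A soft set over $X$ (with parameter set $E$) is $(F,E)=\{(e,F(e)) : e\in E\}$ where $F:E\to\mathcal{P}(X)$ is a map; $S_E(X)$ is the family of all soft sets. Inclusion, unions, intersections and complements of soft sets are taken parameterwise. The null soft set $\widetilde{\Phi}$ has $F(e)=\emptyset$ for all $e$; the absolute soft set $\widetilde{X}$ has $F(e)=X$ for all $e$. A soft topology on $X$ is a collection of soft sets containing $\widetilde{\Phi}$ and $\widetilde{X}$, closed under pairwise intersections and arbitrary unions; its members are called soft open sets and their complements soft closed sets. The soft topology generated by $\boldsymbol{\Sigma}=\{\Sigma_e : e\in E\}$ is $\mathcal{T}(\boldsymbol{\Sigma})=\{(F,E)\in S_E(X) : F(e)\in\Sigma_e \text{ for all } e\in E\}$. A soft topology on $X$ is soft normal if for all soft closed sets $(F,E),(D,E)$ with $(F,E)\cap(D,E)=\widetilde{\Phi}$ there exist soft open sets $(U,E),(V,E)$ such that $(F,E)\subseteq(U,E)$, $(D,E)\subseteq(V,E)$ and $(U,E)\cap(V,E)=\widetilde{\Phi}$. *)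

theory Defs
  imports "HOL-Analysis.Analysis"
begin

(* A soft set (F,E) over X is represented by its parameter map, taken extensional on E
   (value undefined outside E), so that equality of soft sets is plain equality of functions
   and coincides with equality of the graphs {(e, F e) | e. e \<in> E}. *)
definition soft_sets :: "'a set \<Rightarrow> 'e set \<Rightarrow> ('e \<Rightarrow> 'a set) set" where
  "soft_sets X E = E \<rightarrow>\<^sub>E Pow X"

definition soft_subset :: "'e set \<Rightarrow> ('e \<Rightarrow> 'a set) \<Rightarrow> ('e \<Rightarrow> 'a set) \<Rightarrow> bool" where
  "soft_subset E F G \<longleftrightarrow> (\<forall>e\<in>E. F e \<subseteq> G e)"

definition soft_Int :: "'e set \<Rightarrow> ('e \<Rightarrow> 'a set) \<Rightarrow> ('e \<Rightarrow> 'a set) \<Rightarrow> 'e \<Rightarrow> 'a set" where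
  "soft_Int E F G = (\<lambda>e\<in>E. F e \<inter> G e)"

definition soft_Union :: "'e set \<Rightarrow> ('e \<Rightarrow> 'a set) set \<Rightarrow> 'e \<Rightarrow> 'a set" where
  "soft_Union E \<F> = (\<lambda>e\<in>E. \<Union>F\<in>\<F>. F e)"

definition soft_Compl :: "'a set \<Rightarrow> 'e set \<Rightarrow> ('e \<Rightarrow> 'a set) \<Rightarrow> 'e \<Rightarrow> 'a set" where
  "soft_Compl X E F = (\<lambda>e\<in>E. X - F e)"

definition null_soft_set :: "'e set \<Rightarrow> 'e \<Rightarrow> 'a set" where
  "null_soft_set E = (\<lambda>e\<in>E. {})"

definition absolute_soft_set :: "'a set \<Rightarrow> 'e set \<Rightarrow> 'e \<Rightarrow> 'a set" where
  "absolute_soft_set X E = (\<lambda>e\<in>E. X)"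

definition soft_topology :: "'a set \<Rightarrow> 'e set \<Rightarrow> ('e \<Rightarrow> 'a set) set \<Rightarrow> bool" where
  "soft_topology X E \<T> \<longleftrightarrow>
     \<T> \<subseteq> soft_sets X E \<and>
     null_soft_set E \<in> \<T> \<and>
     absolute_soft_set X E \<in> \<T> \<and>
     (\<forall>F\<in>\<T>. \<forall>G\<in>\<T>. soft_Int E F G \<in> \<T>) \<and>
     (\<forall>\<F>. \<F> \<subseteq> \<T> \<longrightarrow> soft_Union E \<F> \<in> \<T>)"

definition soft_closed_sets :: "'a set \<Rightarrow> 'e set \<Rightarrow> ('e \<Rightarrow> 'a set) set \<Rightarrow> ('e \<Rightarrow> 'a set) set" where
  "soft_closed_sets X E \<T> = soft_Compl X E ` \<T>"

definition soft_normal_space :: "'a set \<Rightarrow> 'e set \<Rightarrow> ('e \<Rightarrow> 'a set) set \<Rightarrow> bool" where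
  "soft_normal_space X E \<T> \<longleftrightarrow>
     soft_topology X E \<T> \<and>
     (\<forall>F \<in> soft_closed_sets X E \<T>. \<forall>D \<in> soft_closed_sets X E \<T>.
        soft_Int E F D = null_soft_set E \<longrightarrow>
        (\<exists>U\<in>\<T>. \<exists>V\<in>\<T>. soft_subset E F U \<and> soft_subset E D V \<and>
                       soft_Int E U V = null_soft_set E))"

definition generated_soft_topology ::
    "'a set \<Rightarrow> 'e set \<Rightarrow> ('e \<Rightarrow> 'a topology) \<Rightarrow> ('e \<Rightarrow> 'a set) set" where
  "generated_soft_topology X E \<Sigma> = {F \<in> soft_sets X E. \<forall>e\<in>E. openin (\<Sigma> e) (F e)}"

end

theory Submission
  imports Defs
begin

lemma soft_Int_eq_null_iff:
  "soft_Int E F G = null_soft_set E \<longleftrightarrow> (\<forall>e\<in>E. disjnt (F e) (G e))"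
  by (auto simp: soft_Int_def null_soft_set_def disjnt_def fun_eq_iff restrict_def)

lemma generated_soft_topology_eq_PiE:
  assumes "\<forall>e\<in>E. topspace (\<Sigma> e) = X"
  shows "generated_soft_topology X E \<Sigma> = (\<Pi>\<^sub>E e\<in>E. {S. openin (\<Sigma> e) S})"
proof -
  have "S \<subseteq> X" if "e \<in> E" "openin (\<Sigma> e) S" for e S
    using assms openin_subset that by metis
  then show ?thesis
    unfolding generated_soft_topology_def soft_sets_def set_eq_iff mem_Collect_eq PiE_iff Pow_iff
    by blast
qed

lemma soft_topology_generated:
  assumes "\<forall>e\<in>E. topspace (\<Sigma> e) = X"
  shows "soft_topology X E (generated_soft_topology X E \<Sigma>)"
  unfolding soft_topology_def
proof (intro conjI ballI allI impI)
  show "generated_soft_topology X E \<Sigma> \<subseteq> soft_sets X E"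
    by (auto simp: generated_soft_topology_def)
  show "null_soft_set E \<in> generated_soft_topology X E \<Sigma>"
    by (simp add: generated_soft_topology_eq_PiE[OF assms] null_soft_set_def)
  have "openin (\<Sigma> e) X" if "e \<in> E" for e
    using assms openin_topspace that by metis
  then show "absolute_soft_set X E \<in> generated_soft_topology X E \<Sigma>"
    by (simp add: generated_soft_topology_eq_PiE[OF assms] absolute_soft_set_def)
next
  fix F G
  assume "F \<in> generated_soft_topology X E \<Sigma>" "G \<in> generated_soft_topology X E \<Sigma>"
  then show "soft_Int E F G \<in> generated_soft_topology X E \<Sigma>"
    by (auto simp: generated_soft_topology_eq_PiE[OF assms] soft_Int_def PiE_iff)
next
  fix \<F>
  assume "\<F> \<subseteq> generated_soft_topology X E \<Sigma>"
  then show "soft_Union E \<F> \<in> generated_soft_topology X E \<Sigma>"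
    by (auto simp: generated_soft_topology_eq_PiE[OF assms] soft_Union_def PiE_iff subset_iff)
qed

lemma soft_closed_sets_generated:
  assumes "\<forall>e\<in>E. topspace (\<Sigma> e) = X"
  shows "soft_closed_sets X E (generated_soft_topology X E \<Sigma>) =
         (\<Pi>\<^sub>E e\<in>E. {S. closedin (\<Sigma> e) S})"
proof (intro equalityI subsetI)
  fix F
  assume "F \<in> soft_closed_sets X E (generated_soft_topology X E \<Sigma>)"
  then obtain G where "F = soft_Compl X E G" "G \<in> (\<Pi>\<^sub>E e\<in>E. {S. openin (\<Sigma> e) S})"
    by (auto simp: soft_closed_sets_def generated_soft_topology_eq_PiE[OF assms])
  then show "F \<in> (\<Pi>\<^sub>E e\<in>E. {S. closedin (\<Sigma> e) S})"
    using assms by (auto simp: soft_Compl_def PiE_iff intro!: closedin_diff)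
next
  fix F
  assume F: "F \<in> (\<Pi>\<^sub>E e\<in>E. {S. closedin (\<Sigma> e) S})"
  then have "\<And>e. e \<in> E \<Longrightarrow> F e \<subseteq> X \<and> openin (\<Sigma> e) (X - F e)"
    using assms by (auto simp: PiE_iff closedin_def)
  moreover from this F have "F = soft_Compl X E (soft_Compl X E F)"
    by (intro ext) (auto simp: soft_Compl_def PiE_iff extensional_def)
  ultimately show "F \<in> soft_closed_sets X E (generated_soft_topology X E \<Sigma>)"
    unfolding soft_closed_sets_def generated_soft_topology_eq_PiE[OF assms]
    by (intro image_eqI[where x = "soft_Compl X E F"]) (auto simp: soft_Compl_def)
qed

theorem theorem5p14:
  fixes X :: "'a set" and E :: "'e set" and \<Sigma> :: "'e \<Rightarrow> 'a topology"
  assumes "\<And>e. e \<in> E \<Longrightarrow> topspace (\<Sigma> e) = X"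
  shows "(\<forall>e\<in>E. normal_space (\<Sigma> e)) \<longleftrightarrow>
         soft_normal_space X E (generated_soft_topology X E \<Sigma>)"
proof -
  let ?O = "\<Pi>\<^sub>E e\<in>E. {S. openin (\<Sigma> e) S}" and ?C = "\<Pi>\<^sub>E e\<in>E. {S. closedin (\<Sigma> e) S}"
  have top: "\<forall>e\<in>E. topspace (\<Sigma> e) = X"
    using assms by blast
  have soft_normal_iff: "soft_normal_space X E (generated_soft_topology X E \<Sigma>) \<longleftrightarrow>
      (\<forall>F\<in>?C. \<forall>D\<in>?C. (\<forall>e\<in>E. disjnt (F e) (D e)) \<longrightarrow>
        (\<exists>U\<in>?O. \<exists>V\<in>?O. (\<forall>e\<in>E. F e \<subseteq> U e) \<and> (\<forall>e\<in>E. D e \<subseteq> V e) \<and>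
          (\<forall>e\<in>E. disjnt (U e) (V e))))"
    unfolding soft_normal_space_def soft_Int_eq_null_iff soft_subset_def
      soft_closed_sets_generated[OF top]
    unfolding generated_soft_topology_eq_PiE[OF top]
    using soft_topology_generated[OF top, unfolded generated_soft_topology_eq_PiE[OF top]]
    by (simp only: simp_thms)
  show ?thesis
    unfolding soft_normal_iff
  proof (intro iffI ballI impI)
    fix F D
    assume normal: "\<forall>e\<in>E. normal_space (\<Sigma> e)" and "F \<in> ?C" "D \<in> ?C"
      and "\<forall>e\<in>E. disjnt (F e) (D e)"
    then have "\<forall>e\<in>E. \<exists>U V. openin (\<Sigma> e) U \<and> openin (\<Sigma> e) V \<and> F e \<subseteq> U \<and> D e \<subseteq> V \<and> disjnt U V"
      by (simp add: normal_space_def PiE_iff)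
    then obtain U V where "\<forall>e\<in>E. openin (\<Sigma> e) (U e) \<and> openin (\<Sigma> e) (V e) \<and>
        F e \<subseteq> U e \<and> D e \<subseteq> V e \<and> disjnt (U e) (V e)"
      by metis
    then show "\<exists>U\<in>?O. \<exists>V\<in>?O. (\<forall>e\<in>E. F e \<subseteq> U e) \<and> (\<forall>e\<in>E. D e \<subseteq> V e) \<and>
        (\<forall>e\<in>E. disjnt (U e) (V e))"
      by (intro bexI[where x = "restrict U E"] bexI[where x = "restrict V E"]) auto
  next
    fix e
    assume soft: "\<forall>F\<in>?C. \<forall>D\<in>?C. (\<forall>e\<in>E. disjnt (F e) (D e)) \<longrightarrow>
        (\<exists>U\<in>?O. \<exists>V\<in>?O. (\<forall>e\<in>E. F e \<subseteq> U e) \<and> (\<forall>e\<in>E. D e \<subseteq> V e) \<and>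
          (\<forall>e\<in>E. disjnt (U e) (V e)))"
      and e: "e \<in> E"
    show "normal_space (\<Sigma> e)"
      unfolding normal_space_def
    proof (intro allI impI)
      fix S T
      assume ST: "closedin (\<Sigma> e) S \<and> closedin (\<Sigma> e) T \<and> disjnt S T"
      define soft_at :: "'a set \<Rightarrow> 'e \<Rightarrow> 'a set"
        where "soft_at A = (\<lambda>e'\<in>E. if e' = e then A else {})" for A
      have "soft_at S \<in> ?C" "soft_at T \<in> ?C" "\<forall>e'\<in>E. disjnt (soft_at S e') (soft_at T e')"
        using ST by (auto simp: soft_at_def)
      from soft[rule_format, OF this(1,2)] this(3) obtain U V where "U \<in> ?O" "V \<in> ?O" "\<forall>e'\<in>E. soft_at S e' \<subseteq> U e'"
        "\<forall>e'\<in>E. soft_at T e' \<subseteq> V e'" "\<forall>e'\<in>E. disjnt (U e') (V e')"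
        by blast
      then have "openin (\<Sigma> e) (U e)" "openin (\<Sigma> e) (V e)" "soft_at S e \<subseteq> U e"
        "soft_at T e \<subseteq> V e" "disjnt (U e) (V e)"
        using e PiE_mem[of _ E _ e] by blast+
      moreover have "soft_at S e = S" "soft_at T e = T"
        using e by (simp_all add: soft_at_def)
      ultimately show "\<exists>U V. openin (\<Sigma> e) U \<and> openin (\<Sigma> e) V \<and> S \<subseteq> U \<and> T \<subseteq> V \<and> disjnt U V"
        by metis
    qed
  qed
qed

end
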